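(* Star graphs are determined by the Smith normal form of the distance Laplacian matrix: if $G$ is a connected graph whose distance Laplacian matrix $F(G)$ has the same Smith normal form over $\mathbb{Z}$ as the distance Laplacian matrix $F(K_{n,1})$ of a star graph $K_{n,1}$, $n\ge 1$, then $G$ is isomorphic to $K_{n,1}$.
   Context: Graphs are simple, finite and connected. $K_{n,1}$ is the star graph on $n+1$ vertices (complete bipartite graph with parts of sizes $n$ and $1$). The distance Laplacian matrix of $G$ is $F(G)=T(G)-D(G)$, where $D(G)$ is the distance matrix (entry $(u,v)$ is the graph distance between $u$ and $v$) and $T(G)$ is the diagonal matrix of transmissions, the transmission of a vertex being the sum of its distances to all other vertices. The Smith normal form of an integer matrix is the unique equivalent (over $\mathbb{Z}$) diagonal matrix $\operatorname{diag}(f_1,\dots,f_r,0,\dots,0)$ with positive integers $f_1\mid f_2\mid\cdots\mid f_r$; two matrices having the same Smith normal form in particular have the same size. *)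

theory Defs
  imports "Graph_Theory.Graph_Theory" "Jordan_Normal_Form.Matrix"
begin

text \<open>
  A finite simple graph is a digraph satisfying \<^locale>\<open>graph\<close>: finite, loop-free, without
  parallel arcs, and symmetric, so that an undirected edge is a pair of opposite arcs.  For such
  digraphs, \<^const>\<open>digraph_iso\<close> is isomorphism of the underlying undirected graphs.
\<close>

definition graph_dist :: "('a, 'b) pre_digraph \<Rightarrow> 'a \<Rightarrow> 'a \<Rightarrow> nat" where
  "graph_dist G u v = (LEAST k. \<exists>p. pre_digraph.awalk G u p v \<and> length p = k)"

text \<open>\<^const>\<open>graph_dist\<close> is the library's shortest-path cost for unit weights.\<close>

lemma (in wf_digraph) mu_unit_weight_eq_graph_dist:
  assumes "u \<rightarrow>\<^sup>* v"
  shows "\<mu> (\<lambda>_. 1) u v = ereal (real (graph_dist G u v))"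
proof -
  have cost: "awalk_cost (\<lambda>_. 1) p = real (length p)" for p
    by (induction p) auto
  from assms obtain p where "awalk u p v"
    unfolding reachable_awalk by blast
  then have "\<exists>k q. awalk u q v \<and> length q = k"
    by blast
  then have "\<exists>q. awalk u q v \<and> length q = graph_dist G u v"
    unfolding graph_dist_def by (rule LeastI_ex)
  then obtain q where q: "awalk u q v" "length q = graph_dist G u v"
    by blast
  have min: "graph_dist G u v \<le> length r" if "awalk u r v" for r
    unfolding graph_dist_def by (rule Least_le) (use that in blast)
  show ?thesis
    unfolding \<mu>_def cost
  proof (rule antisym)
    show "(INF r\<in>{r. awalk u r v}. ereal (real (length r))) \<le> ereal (real (graph_dist G u v))"
      by (rule INF_lower2[of q]) (simp_all add: q)
    show "ereal (real (graph_dist G u v)) \<le> (INF r\<in>{r. awalk u r v}. ereal (real (length r)))"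
      by (rule INF_greatest) (simp add: min)
  qed
qed

definition transmission :: "('a, 'b) pre_digraph \<Rightarrow> 'a \<Rightarrow> nat" where
  "transmission G v = (\<Sum>w \<in> verts G - {v}. graph_dist G v w)"

text \<open>
  Matrices of a graph are taken with respect to a listing \<open>vs\<close> of its vertices without
  repetitions; row and column \<open>i\<close> belong to the vertex \<open>vs ! i\<close>.
\<close>

definition is_vertex_listing :: "('a, 'b) pre_digraph \<Rightarrow> 'a list \<Rightarrow> bool" where
  "is_vertex_listing G vs \<longleftrightarrow> distinct vs \<and> set vs = verts G"

definition distance_mat :: "('a, 'b) pre_digraph \<Rightarrow> 'a list \<Rightarrow> int mat" where
  "distance_mat G vs =
     mat (length vs) (length vs) (\<lambda>(i, j). int (graph_dist G (vs ! i) (vs ! j)))"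

definition transmission_mat :: "('a, 'b) pre_digraph \<Rightarrow> 'a list \<Rightarrow> int mat" where
  "transmission_mat G vs =
     mat (length vs) (length vs) (\<lambda>(i, j). if i = j then int (transmission G (vs ! i)) else 0)"

definition distance_laplacian_mat :: "('a, 'b) pre_digraph \<Rightarrow> 'a list \<Rightarrow> int mat" where
  "distance_laplacian_mat G vs = transmission_mat G vs - distance_mat G vs"

text \<open>
  Over \<^typ>\<open>int\<close>, \<^const>\<open>invertible_mat\<close> asks for an inverse with integer entries, i.e. it
  describes the unimodular matrices.
\<close>

definition equivalent_int_mat :: "int mat \<Rightarrow> int mat \<Rightarrow> bool" where
  "equivalent_int_mat A B \<longleftrightarrow>
     (\<exists>P Q. P \<in> carrier_mat (dim_row A) (dim_row A) \<and> Q \<in> carrier_mat (dim_col A) (dim_col A) \<and>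
        invertible_mat P \<and> invertible_mat Q \<and> B = P * A * Q)"

definition is_smith_normal_form :: "int mat \<Rightarrow> int mat \<Rightarrow> bool" where
  "is_smith_normal_form A S \<longleftrightarrow>
     equivalent_int_mat A S \<and>
     (\<exists>fs. length fs \<le> min (dim_row A) (dim_col A) \<and> (\<forall>f \<in> set fs. f > 0) \<and> sorted_wrt (dvd) fs \<and>
        S = mat (dim_row A) (dim_col A) (\<lambda>(i, j). if i = j \<and> i < length fs then fs ! i else 0))"

text \<open>
  As the Smith normal form exists and is unique, two matrices have the same one iff they share
  some Smith normal form.
\<close>

definition same_smith_normal_form :: "int mat \<Rightarrow> int mat \<Rightarrow> bool" where
  "same_smith_normal_form A B \<longleftrightarrow> (\<exists>S. is_smith_normal_form A S \<and> is_smith_normal_form B S)"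

end

theory Submission
  imports Defs "HOL-Number_Theory.Cong"
begin

text \<open>
  The Smith normal form of \<open>F(K\<^bsub>n,1\<^esub>)\<close> is \<open>diag(1, q, \<dots>, q, 0)\<close> with \<open>q = 2n + 1\<close>.  It shows
  itself in that \<open>F(K\<^bsub>n,1\<^esub>)\<close> is modulo \<open>q\<close> the product of a column and a row.  This property
  survives multiplication by integer matrices on either side, so it passes to every matrix with
  the same Smith normal form
  (\<open>rank_le_one_mod_same_smith_normal_form\<close>, \<open>star_distance_laplacian_rank_le_one\<close>).

  Let \<open>G\<close> be connected on \<open>n + 1\<close> vertices, with \<open>F(G)\<close> of that kind.  Then every \<open>2 \<times> 2\<close> minor of
  \<open>F(G)\<close> vanishes modulo \<open>q\<close>, and well-chosen minors around short geodesics leave only the star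
  (\<open>star_if_distance_laplacian_minors_vanish\<close>):
  \<^item> A geodesic of length at least 3 gives \<open>q dvd 2\<close>, which is absurd as \<open>q\<close> is at least 3.
    So all distances are at most 2.
  \<^item> The middle vertex \<open>c\<close> of a geodesic of length 2 has a transmission \<open>t\<close> with \<open>q dvd 2t + 1\<close>.  As the
    distances from \<open>c\<close> to the \<open>n\<close> other vertices are 1 or 2, \<open>n \<le> t \<le> 2n\<close>, which forces \<open>t = n\<close>:
    the vertex \<open>c\<close> is adjacent to all others.  If there is no such geodesic, \<open>G\<close> is complete and
    any vertex serves as \<open>c\<close>.
  \<^item> An edge between two vertices other than \<open>c\<close> gives \<open>q dvd n + 1\<close>, although \<open>0 < n + 1 < q\<close>.
    So \<open>c\<close> lies on every edge.

  The number \<open>n\<close> itself is read off from the size of the matrix, and two stars of the same size are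
  isomorphic.
\<close>

section \<open>Integer matrices of rank at most one modulo an integer\<close>

text \<open>
  The modulus may be composite.  An explicit factorization into a column and a row is then a
  stronger demand than vanishing of all \<open>2 \<times> 2\<close> minors, and it is the form that is immediately
  stable under matrix multiplication.
\<close>

definition rank_le_one_mod :: "int \<Rightarrow> int mat \<Rightarrow> bool" where
  "rank_le_one_mod q A \<longleftrightarrow>
     (\<exists>a b. \<forall>i < dim_row A. \<forall>j < dim_col A. [A $$ (i, j) = a i * b j] (mod q))"

lemma rank_le_one_modE:
  assumes "rank_le_one_mod q A"
  obtains a b where "\<And>i j. i < dim_row A \<Longrightarrow> j < dim_col A \<Longrightarrow> [A $$ (i, j) = a i * b j] (mod q)"
  using assms unfolding rank_le_one_mod_def by blast

lemma rank_le_one_mod_minor: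
  assumes "rank_le_one_mod q A"
    and "i < dim_row A" "k < dim_row A" "j < dim_col A" "l < dim_col A"
  shows "[A $$ (i, j) * A $$ (k, l) = A $$ (i, l) * A $$ (k, j)] (mod q)"
proof -
  obtain a b where ab: "\<And>i j. i < dim_row A \<Longrightarrow> j < dim_col A \<Longrightarrow> [A $$ (i, j) = a i * b j] (mod q)"
    using assms(1) by (rule rank_le_one_modE) blast
  have "[A $$ (i, j) * A $$ (k, l) = (a i * b j) * (a k * b l)] (mod q)"
    using assms by (intro cong_mult ab)
  also have "(a i * b j) * (a k * b l) = (a i * b l) * (a k * b j)"
    by simp
  also have "[\<dots> = A $$ (i, l) * A $$ (k, j)] (mod q)"
    using assms by (intro cong_mult cong_sym[OF ab])
  finally show ?thesis .
qed

lemma rank_le_one_mod_mult_left: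
  assumes "rank_le_one_mod q A" and "dim_col P = dim_row A"
  shows "rank_le_one_mod q (P * A)"
proof -
  obtain a b where ab: "\<And>i j. i < dim_row A \<Longrightarrow> j < dim_col A \<Longrightarrow> [A $$ (i, j) = a i * b j] (mod q)"
    using assms(1) by (rule rank_le_one_modE) blast
  have "[(P * A) $$ (i, j) = (\<Sum>k = 0..<dim_row A. P $$ (i, k) * a k) * b j] (mod q)"
    if "i < dim_row P" "j < dim_col A" for i j
  proof -
    have "(P * A) $$ (i, j) = (\<Sum>k = 0..<dim_row A. P $$ (i, k) * A $$ (k, j))"
      using that assms(2) by (simp add: scalar_prod_def)
    also have "[\<dots> = (\<Sum>k = 0..<dim_row A. P $$ (i, k) * (a k * b j))] (mod q)"
      using that by (intro cong_sum cong_mult cong_refl ab) auto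
    finally show ?thesis
      by (simp add: sum_distrib_right mult.assoc)
  qed
  then show ?thesis
    unfolding rank_le_one_mod_def
    by (intro exI[of _ "\<lambda>i. \<Sum>k = 0..<dim_row A. P $$ (i, k) * a k"] exI[of _ b]) simp
qed

lemma rank_le_one_mod_mult_right:
  assumes "rank_le_one_mod q A" and "dim_row Q = dim_col A"
  shows "rank_le_one_mod q (A * Q)"
proof -
  obtain a b where ab: "\<And>i j. i < dim_row A \<Longrightarrow> j < dim_col A \<Longrightarrow> [A $$ (i, j) = a i * b j] (mod q)"
    using assms(1) by (rule rank_le_one_modE) blast
  have "[(A * Q) $$ (i, j) = a i * (\<Sum>k = 0..<dim_col A. b k * Q $$ (k, j))] (mod q)"
    if "i < dim_row A" "j < dim_col Q" for i j
  proof -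
    have "(A * Q) $$ (i, j) = (\<Sum>k = 0..<dim_col A. A $$ (i, k) * Q $$ (k, j))"
      using that assms(2) by (simp add: scalar_prod_def)
    also have "[\<dots> = (\<Sum>k = 0..<dim_col A. (a i * b k) * Q $$ (k, j))] (mod q)"
      using that by (intro cong_sum cong_mult cong_refl ab) auto
    finally show ?thesis
      by (simp add: sum_distrib_left mult.assoc)
  qed
  then show ?thesis
    unfolding rank_le_one_mod_def
    by (intro exI[of _ a] exI[of _ "\<lambda>j. \<Sum>k = 0..<dim_col A. b k * Q $$ (k, j)"]) simp
qed

text \<open>
  The library notion of invertibility leaves the shape of the inverse open; comparing dimensions in
  the two product identities shows that it is square of the same size.
\<close>

lemma invertible_int_matE:
  assumes "invertible_mat P" and "P \<in> carrier_mat n n"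
  obtains R where "R \<in> carrier_mat n n" "R * P = 1\<^sub>m n" "P * R = 1\<^sub>m n"
proof -
  obtain R where R: "P * R = 1\<^sub>m (dim_row P)" "R * P = 1\<^sub>m (dim_row R)"
    using assms(1) unfolding invertible_mat_def inverts_mat_def by blast
  have "dim_col R = n"
    using arg_cong[OF R(1), of dim_col] assms(2) by simp
  moreover have "dim_row R = n"
    using arg_cong[OF R(2), of dim_col] assms(2) by simp
  ultimately show thesis
    using R assms(2) by (intro that[of R]) auto
qed

lemma equivalent_int_mat_dims:
  assumes "equivalent_int_mat A B"
  shows "dim_row B = dim_row A" "dim_col B = dim_col A"
  using assms unfolding equivalent_int_mat_def by auto

lemma equivalent_int_mat_sym:
  assumes "equivalent_int_mat A B"
  shows "equivalent_int_mat B A"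
proof -
  let ?r = "dim_row A" and ?c = "dim_col A"
  obtain P Q where P: "P \<in> carrier_mat ?r ?r" "invertible_mat P"
    and Q: "Q \<in> carrier_mat ?c ?c" "invertible_mat Q" and B: "B = P * A * Q"
    using assms unfolding equivalent_int_mat_def by blast
  obtain P' where P': "P' \<in> carrier_mat ?r ?r" "P' * P = 1\<^sub>m ?r" "P * P' = 1\<^sub>m ?r"
    using P(2,1) by (rule invertible_int_matE)
  obtain Q' where Q': "Q' \<in> carrier_mat ?c ?c" "Q' * Q = 1\<^sub>m ?c" "Q * Q' = 1\<^sub>m ?c"
    using Q(2,1) by (rule invertible_int_matE)
  have A: "A \<in> carrier_mat ?r ?c"
    by auto
  have PA: "P * A \<in> carrier_mat ?r ?c"
    using P(1) A by (rule mult_carrier_mat)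
  have "P' * B * Q' = P' * (P * A * Q * Q')"
    unfolding B using P'(1) mult_carrier_mat[OF PA Q(1)] Q'(1) by (rule assoc_mult_mat)
  also have "P * A * Q * Q' = P * A"
    unfolding assoc_mult_mat[OF PA Q(1) Q'(1)] Q'(3) using PA by simp
  also have "P' * (P * A) = A"
    unfolding assoc_mult_mat[OF P'(1) P(1) A, symmetric] P'(2) using A by simp
  finally have "A = P' * B * Q'" ..
  moreover have "invertible_mat P'" "invertible_mat Q'"
    using P P' Q Q' unfolding invertible_mat_def inverts_mat_def by auto
  ultimately show ?thesis
    using P'(1) Q'(1) equivalent_int_mat_dims[OF assms]
    unfolding equivalent_int_mat_def by metis
qed

lemma rank_le_one_mod_equivalent:
  assumes "equivalent_int_mat A B" and "rank_le_one_mod q A"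
  shows "rank_le_one_mod q B"
proof -
  obtain P Q where "P \<in> carrier_mat (dim_row A) (dim_row A)"
    "Q \<in> carrier_mat (dim_col A) (dim_col A)" and B: "B = P * A * Q"
    using assms(1) unfolding equivalent_int_mat_def by blast
  then show ?thesis
    unfolding B
    by (intro rank_le_one_mod_mult_right rank_le_one_mod_mult_left assms(2)) simp_all
qed

lemma same_smith_normal_form_dim_row:
  assumes "same_smith_normal_form A B"
  shows "dim_row A = dim_row B"
  using assms equivalent_int_mat_dims(1)
  unfolding same_smith_normal_form_def is_smith_normal_form_def by metis

text \<open>
  Both matrices are equivalent to one and the same diagonal matrix, so the factorization travels from
  the one to the other through it.
\<close>

lemma rank_le_one_mod_same_smith_normal_form:
  assumes "same_smith_normal_form A B" and "rank_le_one_mod q B"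
  shows "rank_le_one_mod q A"
  using assms rank_le_one_mod_equivalent equivalent_int_mat_sym
  unfolding same_smith_normal_form_def is_smith_normal_form_def by metis

section \<open>Graph distance\<close>

context wf_digraph
begin

lemma graph_dist_le_length: "awalk u p v \<Longrightarrow> graph_dist G u v \<le> length p"
  unfolding graph_dist_def by (intro Least_le exI[of _ p]) simp

lemma shortest_awalkE:
  assumes "u \<rightarrow>\<^sup>* v"
  obtains p where "awalk u p v" "length p = graph_dist G u v"
proof -
  have "\<exists>k p. awalk u p v \<and> length p = k"
    using assms unfolding reachable_awalk by blast
  then have "\<exists>p. awalk u p v \<and> length p = graph_dist G u v"
    unfolding graph_dist_def by (rule LeastI_ex)
  then show thesis
    using that by blast
qed

lemma graph_dist_pos:
  assumes "u \<rightarrow>\<^sup>* v" "u \<noteq> v"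
  shows "graph_dist G u v \<ge> 1"
proof -
  obtain p where "awalk u p v" "length p = graph_dist G u v"
    using assms(1) by (rule shortest_awalkE)
  then show ?thesis
    using assms(2) by (cases p) (auto simp: awalk_Nil_iff)
qed

lemma graph_dist_step_le:
  assumes "u \<rightarrow> w" "w \<rightarrow>\<^sup>* v"
  shows "graph_dist G u v \<le> Suc (graph_dist G w v)"
proof -
  obtain p where p: "awalk w p v" "length p = graph_dist G w v"
    using assms(2) by (rule shortest_awalkE)
  obtain e where "e \<in> arcs G" "tail G e = u" "head G e = w"
    using assms(1) by (rule reachableE)
  then have "awalk u (e # p) v"
    using p by (simp add: awalk_Cons_iff)
  then show ?thesis
    using graph_dist_le_length p by force
qed

lemma graph_dist_self: "u \<in> verts G \<Longrightarrow> graph_dist G u u = 0"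
  using graph_dist_le_length[of u "[]" u] by (simp add: awalk_Nil_iff)

text \<open>
  A first step along a shortest walk; repeating it produces the initial vertices of a geodesic
  together with their distances to its end.
\<close>

lemma graph_dist_step:
  assumes "u \<rightarrow>\<^sup>* v" "graph_dist G u v = Suc k"
  obtains w where "u \<rightarrow> w" "w \<rightarrow>\<^sup>* v" "graph_dist G w v = k"
proof -
  obtain p where p: "awalk u p v" "length p = graph_dist G u v"
    using assms(1) by (rule shortest_awalkE)
  then obtain e es where "p = e # es" "length es = k"
    using assms(2) by (cases p) auto
  then have e: "e \<in> arcs G" "tail G e = u" "awalk (head G e) es v"
    using p(1) by (auto simp: awalk_Cons_iff)
  have r: "u \<rightarrow> head G e" "head G e \<rightarrow>\<^sup>* v"
    using e unfolding reachable_awalk by (auto simp: arcs_ends_conv)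
  have "graph_dist G (head G e) v = k"
    using graph_dist_le_length[OF e(3)] graph_dist_step_le[OF r] \<open>length es = k\<close> assms(2) by simp
  with r show thesis
    by (rule that)
qed

lemma graph_dist_eq_0D:
  assumes "u \<rightarrow>\<^sup>* v" "graph_dist G u v = 0"
  shows "u = v"
  using graph_dist_pos assms by fastforce

lemma graph_dist_eq_1D:
  assumes "u \<rightarrow>\<^sup>* v" "graph_dist G u v = 1"
  shows "u \<rightarrow> v"
proof -
  obtain w where w: "u \<rightarrow> w" "w \<rightarrow>\<^sup>* v" "graph_dist G w v = 0"
    using assms graph_dist_step[of u v 0] by auto
  then show ?thesis
    using graph_dist_eq_0D[OF w(2,3)] by simp
qed

end

lemma (in loopfree_digraph) graph_dist_adjacent:
  assumes "u \<rightarrow> v"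
  shows "graph_dist G u v = 1"
  using graph_dist_step_le[OF assms, of v] graph_dist_pos[of u v] graph_dist_self[of v]
    assms adj_not_same adj_in_verts by force

section \<open>Stars\<close>

definition star_with_centre :: "('a, 'b) pre_digraph \<Rightarrow> 'a \<Rightarrow> bool" where
  "star_with_centre G c \<longleftrightarrow> c \<in> verts G \<and>
     arcs_ends G = (verts G - {c}) \<times> {c} \<union> {c} \<times> (verts G - {c})"

lemma complete_bipartite_digraph_1E:
  assumes "complete_bipartite_digraph n 1 K"
  obtains c where "graph K" "star_with_centre K c" "card (verts K) = Suc n"
proof -
  obtain U V where UV: "graph K" "verts K = U \<union> V" "U \<inter> V = {}" "card U = n" "card V = 1"
    "arcs_ends K = U \<times> V \<union> V \<times> U"
    using assms unfolding complete_bipartite_digraph_def by blast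
  then obtain c where c: "V = {c}"
    by (auto simp: card_1_singleton_iff)
  have "finite U"
    using UV(1,2) fin_digraph.finite_verts[of K] by (auto simp: graph_def digraph_def)
  moreover have verts: "verts K = insert c U" "c \<notin> U"
    using UV(2,3) c by auto
  moreover have "star_with_centre K c"
    unfolding star_with_centre_def using UV(6) verts c by simp
  ultimately show thesis
    using UV(1,4) by (intro that[of c]) simp_all
qed

text \<open>
  Without parallel arcs an arc is determined by its ends, so a vertex bijection that respects
  adjacency carries a unique arc bijection along with it.
\<close>

lemma digraph_isoI_arcs_ends:
  assumes G: "nomulti_digraph G" and H: "nomulti_digraph H"
    and f: "bij_betw f (verts G) (verts H)"
    and ends: "map_prod f f ` arcs_ends G = arcs_ends H"
  shows "digraph_iso G H"
proof -
  interpret G: nomulti_digraph G by fact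
  interpret H: nomulti_digraph H by fact
  define g where "g = the_inv_into (arcs H) (arc_to_ends H) \<circ> map_prod f f \<circ> arc_to_ends G"
  have inj_f: "inj_on (map_prod f f) (arcs_ends G)"
  proof (rule inj_on_subset)
    show "inj_on (map_prod f f) (verts G \<times> verts G)"
      using f by (intro map_prod_inj_on) (simp_all add: bij_betw_def)
    show "arcs_ends G \<subseteq> verts G \<times> verts G"
      by (auto dest: G.adj_in_verts)
  qed
  have "bij_betw (arc_to_ends G) (arcs G) (arcs_ends G)"
    using G.inj_on_arc_to_ends by (simp add: bij_betw_def arcs_ends_def)
  moreover have "bij_betw (map_prod f f) (arcs_ends G) (arcs_ends H)"
    using inj_f ends by (simp add: bij_betw_def)
  moreover have bij_H: "bij_betw (arc_to_ends H) (arcs H) (arcs_ends H)"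
    using H.inj_on_arc_to_ends by (simp add: bij_betw_def arcs_ends_def)
  ultimately have g: "bij_betw g (arcs G) (arcs H)"
    unfolding g_def by (intro bij_betw_trans bij_betw_the_inv_into)
  have ends_g: "arc_to_ends H (g a) = map_prod f f (arc_to_ends G a)" if "a \<in> arcs G" for a
    unfolding g_def o_apply using that ends
    by (intro f_the_inv_into_f_bij_betw[OF bij_H]) (auto simp: arcs_ends_def)
  \<comment> \<open>An isomorphic image takes its incidence maps from the isomorphism, also outside the arc set,
    so that only the full maps of \<open>H\<close> yield equality with \<open>H\<close>.\<close>
  let ?h = "\<lparr>iso_verts = f, iso_arcs = g, iso_head = head H, iso_tail = tail H\<rparr>"
  have "G.digraph_isomorphism ?h"
    using f g ends_g G.wf_digraph
    by (auto simp: G.digraph_isomorphism_def bij_betw_def arc_to_ends_def)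
  moreover have "H = app_iso ?h G"
    using f g by (intro pre_digraph.equality) (auto simp: bij_betw_def)
  ultimately show ?thesis
    unfolding digraph_iso_def by blast
qed

lemma stars_of_equal_size_isomorphic:
  assumes "graph G" "graph H" "star_with_centre G c" "star_with_centre H d"
    and "card (verts G) = card (verts H)"
  shows "digraph_iso G H"
proof -
  interpret G: graph G by fact
  interpret H: graph H by fact
  have cd: "c \<in> verts G" "d \<in> verts H"
    using assms by (auto simp: star_with_centre_def)
  then have "card (verts G - {c}) = card (verts H - {d})"
    using assms(5) by simp
  then obtain g where g: "bij_betw g (verts G - {c}) (verts H - {d})"
    by (metis G.finite_verts H.finite_verts finite_Diff finite_same_card_bij)
  define f where "f = g(c := d)"
  have f_leaves: "f ` (verts G - {c}) = verts H - {d}"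
    using g by (auto simp: f_def bij_betw_def)
  have "bij_betw f (verts G - {c}) (verts H - {d})"
    using g by (subst bij_betw_cong[of _ _ g]) (auto simp: f_def)
  moreover have "bij_betw f {c} {d}"
    by (simp add: f_def bij_betw_def)
  ultimately have "bij_betw f (verts G - {c} \<union> {c}) (verts H - {d} \<union> {d})"
    by (rule bij_betw_combine) simp
  moreover have "verts G - {c} \<union> {c} = verts G" "verts H - {d} \<union> {d} = verts H"
    using cd by auto
  ultimately have "bij_betw f (verts G) (verts H)"
    by simp
  moreover have "map_prod f f ` arcs_ends G = arcs_ends H"
    using assms(3,4) f_leaves
    by (simp add: star_with_centre_def image_Un map_prod_surj_on f_def)
  ultimately show ?thesis
    by (intro digraph_isoI_arcs_ends G.nomulti_digraph H.nomulti_digraph)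
qed

section \<open>The distance Laplacian modulo 2n + 1\<close>

text \<open>Indexing by vertices makes arguments about geodesics independent of the vertex listing.\<close>

definition distance_laplacian_entry :: "('a, 'b) pre_digraph \<Rightarrow> 'a \<Rightarrow> 'a \<Rightarrow> int" where
  "distance_laplacian_entry G u v =
     (if u = v then int (transmission G u) else - int (graph_dist G u v))"

lemma (in wf_digraph) distance_laplacian_mat_entry:
  assumes "is_vertex_listing G vs" "i < length vs" "j < length vs"
  shows "distance_laplacian_mat G vs $$ (i, j) = distance_laplacian_entry G (vs ! i) (vs ! j)"
proof -
  have "vs ! i \<in> verts G"
    using assms unfolding is_vertex_listing_def by (metis nth_mem)
  moreover have "vs ! i = vs ! j \<longleftrightarrow> i = j"
    using assms unfolding is_vertex_listing_def by (simp add: nth_eq_iff_index_eq)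
  ultimately show ?thesis
    using assms graph_dist_self
    by (auto simp: distance_laplacian_mat_def transmission_mat_def distance_mat_def
        distance_laplacian_entry_def)
qed

lemma distance_laplacian_mat_dims [simp]:
  "dim_row (distance_laplacian_mat G vs) = length vs"
  "dim_col (distance_laplacian_mat G vs) = length vs"
  by (simp_all add: distance_laplacian_mat_def distance_mat_def)

lemma length_vertex_listing: "is_vertex_listing G vs \<Longrightarrow> length vs = card (verts G)"
  using distinct_card[of vs] by (simp add: is_vertex_listing_def)

text \<open>
  Two leaves are at distance 2, and a leaf has transmission \<open>2n - 1\<close>, which is congruent to \<open>- 2\<close>
  modulo \<open>2n + 1\<close>.  So the diagonal is indistinguishable from the other entries in the block of
  the leaves, which becomes constant.  The rows of the leaves then all agree, and they are twice the
  row of the centre because \<open>2n\<close> is congruent to \<open>- 1\<close>.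
\<close>

lemma star_distance_laplacian_rank_le_one:
  assumes "graph K" "star_with_centre K c" "card (verts K) = Suc n" "is_vertex_listing K ws"
  shows "rank_le_one_mod (2 * int n + 1) (distance_laplacian_mat K ws)"
proof -
  interpret K: graph K by fact
  let ?q = "2 * int n + 1" and ?L = "verts K - {c}"
  have c: "c \<in> verts K"
    using assms(2) by (simp add: star_with_centre_def)
  have adj: "x \<rightarrow>\<^bsub>K\<^esub> y \<longleftrightarrow> (x \<in> ?L \<and> y = c) \<or> (x = c \<and> y \<in> ?L)" for x y
    using assms(2) by (auto simp: star_with_centre_def)
  have dist1: "graph_dist K c x = 1" "graph_dist K x c = 1" if "x \<in> ?L" for x
    using that by (simp_all add: K.graph_dist_adjacent adj del: One_nat_def)
  have dist2: "graph_dist K x y = 2" if "x \<in> ?L" "y \<in> ?L" "x \<noteq> y" for x y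
  proof -
    have steps: "x \<rightarrow>\<^bsub>K\<^esub> c" "c \<rightarrow>\<^bsub>K\<^esub> y"
      using that by (simp_all add: adj)
    then have r: "x \<rightarrow>\<^sup>*\<^bsub>K\<^esub> y"
      by (meson K.adj_reachable_trans K.reachable_adjI)
    have "graph_dist K x y \<le> 2"
      using K.graph_dist_step_le[OF steps(1) K.reachable_adjI[OF steps(2)]] dist1(1) that by simp
    moreover have "graph_dist K x y \<noteq> 1"
      using K.graph_dist_eq_1D[OF r] that by (auto simp: adj)
    ultimately show ?thesis
      using K.graph_dist_pos[OF r that(3)] by simp
  qed
  have card_L: "card ?L = n"
    using c assms(3) by simp
  have trans_c: "transmission K c = n"
    using dist1(1) card_L by (simp add: transmission_def)
  have trans_leaf: "int (transmission K x) = ?q - 2" if "x \<in> ?L" for x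
  proof -
    have "verts K - {x} = insert c (?L - {x})"
      using that c by auto
    then have "transmission K x = graph_dist K x c + (\<Sum>w \<in> ?L - {x}. graph_dist K x w)"
      by (simp add: transmission_def)
    also have "(\<Sum>w \<in> ?L - {x}. graph_dist K x w) = (\<Sum>w \<in> ?L - {x}. 2)"
      using dist2 that by (intro sum.cong) auto
    also have "\<dots> = 2 * (n - 1)"
      using that card_L by simp
    finally have "transmission K x = 1 + 2 * (n - 1)"
      using dist1(2)[OF that] by simp
    moreover have "n \<ge> 1"
      using that card_L by (metis K.finite_verts One_nat_def Suc_leI card_gt_0_iff empty_iff finite_Diff)
    ultimately show ?thesis
      by simp
  qed
  \<comment> \<open>Here \<open>b\<close> is the row of the centre, and \<open>a\<close> the multiple of it found in each row.\<close>
  define a b :: "_ \<Rightarrow> int" where "a x = (if x = c then 1 else 2)" and "b x = (if x = c then int n else - 1)" for x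
  have q_dvd: "?q dvd 1 + 2 * int n" "?q dvd - 1 - 2 * int n"
    by (auto intro: dvdI[of _ _ 1] dvdI[of _ _ "- 1"])
  have entry: "[distance_laplacian_entry K x y = a x * b y] (mod ?q)"
    if xy: "x \<in> verts K" "y \<in> verts K" for x y
  proof -
    consider "x = c" "y = c" | "x = c" "y \<in> ?L" | "x \<in> ?L" "y = c"
      | "x \<in> ?L" "y = x" | "x \<in> ?L" "y \<in> ?L" "x \<noteq> y"
      using xy by blast
    then show ?thesis
      by cases (auto simp: distance_laplacian_entry_def a_def b_def trans_c trans_leaf dist1 dist2
          cong_iff_dvd_diff q_dvd)
  qed
  have "ws ! i \<in> verts K" if "i < length ws" for i
    using assms(4) that unfolding is_vertex_listing_def by (metis nth_mem)
  then have "[distance_laplacian_mat K ws $$ (i, j) = a (ws ! i) * b (ws ! j)] (mod ?q)"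
    if "i < length ws" "j < length ws" for i j
    using that entry K.distance_laplacian_mat_entry[OF assms(4)] by simp
  then show ?thesis
    unfolding rank_le_one_mod_def
    by (intro exI[of _ "\<lambda>i. a (ws ! i)"] exI[of _ "\<lambda>j. b (ws ! j)"]) simp
qed

section \<open>Graphs whose distance Laplacian has rank at most one modulo 2n + 1\<close>

text \<open>
  Each step uses a minor whose four entries are known: adjacent vertices contribute \<open>- 1\<close>, and
  the vertices on a geodesic have known distances to its end.  No transmission enters until the
  diameter is bounded, and afterwards only that of the centre.
\<close>

lemma star_if_distance_laplacian_minors_vanish:
  assumes "graph G" "Digraph_Component.connected G" "card (verts G) = Suc n" "n \<ge> 1"
    and minor: "\<And>u v x y. \<lbrakk>u \<in> verts G; v \<in> verts G; x \<in> verts G; y \<in> verts G\<rbrakk> \<Longrightarrow>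
      [distance_laplacian_entry G u x * distance_laplacian_entry G v y =
       distance_laplacian_entry G u y * distance_laplacian_entry G v x] (mod (2 * int n + 1))"
  shows "\<exists>c. star_with_centre G c"
proof -
  interpret G: graph G by fact
  let ?q = "2 * int n + 1" and ?F = "distance_laplacian_entry G"
  have reach: "u \<rightarrow>\<^sup>*\<^bsub>G\<^esub> v" if "u \<in> verts G" "v \<in> verts G" for u v
    using assms(2) that G.reachable_mk_symmetric_eq[OF G.sym_arcs]
    by (auto simp: Digraph_Component.connected_def strongly_connected_def)
  have F_off: "?F u v = - int (graph_dist G u v)" if "u \<noteq> v" for u v
    using that by (simp add: distance_laplacian_entry_def)
  have F_adj: "?F u v = - 1" "?F v u = - 1" if "u \<rightarrow>\<^bsub>G\<^esub> v" for u v
    using that G.graph_symmetric[OF that] G.adj_not_same G.graph_dist_adjacent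
    by (auto simp: distance_laplacian_entry_def)
  have diam: "graph_dist G u v \<le> 2" if uv: "u \<in> verts G" "v \<in> verts G" for u v
  proof (rule ccontr)
    assume "\<not> graph_dist G u v \<le> 2"
    then obtain k where "graph_dist G u v = 3 + k"
      using le_Suc_ex[of 3 "graph_dist G u v"] by auto
    then have k: "graph_dist G u v = Suc (Suc (Suc k))"
      by simp
    obtain x where x: "u \<rightarrow>\<^bsub>G\<^esub> x" "x \<rightarrow>\<^sup>*\<^bsub>G\<^esub> v" "graph_dist G x v = Suc (Suc k)"
      using reach[OF uv] k by (rule G.graph_dist_step)
    obtain y where y: "x \<rightarrow>\<^bsub>G\<^esub> y" "y \<rightarrow>\<^sup>*\<^bsub>G\<^esub> v" "graph_dist G y v = Suc k"
      using x(2,3) by (rule G.graph_dist_step)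
    \<comment> \<open>The geodesic starts with \<open>u\<close>, \<open>x\<close>, \<open>y\<close>.  Rows \<open>u\<close>, \<open>y\<close> and columns \<open>x\<close>, \<open>v\<close> avoid the
      diagonal; both entries in column \<open>x\<close> are \<open>- 1\<close>, and those in column \<open>v\<close> differ by 2.\<close>
    have "u \<noteq> v" "y \<noteq> v"
      using k y(3) G.graph_dist_self[OF uv(2)] by auto
    then have "[int k + 3 = int k + 1] (mod ?q)"
      using minor[of u y x v] uv x y k G.adj_in_verts F_adj[OF x(1)] F_adj[OF y(1)]
      by (simp add: F_off cong_sym_eq add.commute)
    then have "?q dvd 2"
      by (simp add: cong_iff_dvd_diff)
    then have "?q \<le> 2"
      by (rule zdvd_imp_le) simp
    then show False
      using \<open>n \<ge> 1\<close> by simp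
  qed
  have "\<exists>c \<in> verts G. \<forall>v \<in> verts G - {c}. graph_dist G c v = 1"
  proof (cases "\<exists>u \<in> verts G. \<exists>v \<in> verts G. graph_dist G u v = 2")
    case True
    then obtain u v where uv: "u \<in> verts G" "v \<in> verts G" "graph_dist G u v = Suc 1"
      by auto
    obtain c where c: "u \<rightarrow>\<^bsub>G\<^esub> c" "c \<rightarrow>\<^sup>*\<^bsub>G\<^esub> v" "graph_dist G c v = 1"
      using reach[OF uv(1,2)] uv(3) by (rule G.graph_dist_step)
    let ?t = "transmission G c"
    have c_vert: "c \<in> verts G"
      using c(1) by (rule G.adj_in_verts)
    have card_rest: "card (verts G - {c}) = n"
      using c_vert assms(3) by simp
    \<comment> \<open>Rows \<open>u\<close>, \<open>c\<close> and columns \<open>c\<close>, \<open>v\<close>: the diagonal entry at \<open>c\<close> meets the distance 2.\<close>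
    have "c \<rightarrow>\<^bsub>G\<^esub> v"
      using G.graph_dist_eq_1D[OF c(2,3)] .
    moreover have "u \<noteq> v"
      using uv G.graph_dist_self by auto
    ultimately have "[1 = - (2 * int ?t)] (mod ?q)"
      using minor[of u c c v] uv c_vert F_adj[OF c(1)] F_adj[of c v]
      by (simp add: F_off) (simp add: distance_laplacian_entry_def mult.commute)
    then have "?q dvd 2 * int ?t + 1"
      by (simp add: cong_iff_dvd_diff add.commute)
    then obtain m where m: "2 * int ?t + 1 = ?q * m" ..
    have "?t \<le> card (verts G - {c}) * 2"
      using sum_bounded_above[of "verts G - {c}" "graph_dist G c" 2] diam c_vert
      by (simp add: transmission_def)
    then have "?q * m < ?q * 2"
      using card_rest m by simp
    then have "m < 2"
      by (rule mult_left_less_imp_less) simp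
    moreover have "0 < ?q * m"
      unfolding m[symmetric] by simp
    then have "0 < m"
      by (rule zero_less_mult_pos) simp
    ultimately have "m = 1"
      by simp
    then have "?t = n"
      using m by simp
    then have "(\<Sum>w \<in> verts G - {c}. graph_dist G c w) = (\<Sum>w \<in> verts G - {c}. 1)"
      using card_rest by (simp add: transmission_def)
    moreover have "1 \<le> graph_dist G c w" if "w \<in> verts G - {c}" for w
      using that c_vert by (intro G.graph_dist_pos reach) auto
    ultimately have "\<forall>w \<in> verts G - {c}. graph_dist G c w = 1"
      using sum_mono_inv[of "\<lambda>_. 1" "verts G - {c}" "graph_dist G c"] G.finite_verts
      by (metis finite_Diff)
    with c_vert show ?thesis ..
  next
    case False
    obtain c where "c \<in> verts G"
      using assms(3) by fastforce
    moreover have "graph_dist G c v = 1" if v: "v \<in> verts G - {c}" for v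
    proof -
      have "graph_dist G c v \<le> 2" "graph_dist G c v \<noteq> 2"
        using False v \<open>c \<in> verts G\<close> diam by blast+
      moreover have "graph_dist G c v \<ge> 1"
        using v \<open>c \<in> verts G\<close> by (intro G.graph_dist_pos reach) auto
      ultimately show ?thesis
        by linarith
    qed
    ultimately show ?thesis
      by blast
  qed
  then obtain c where c: "c \<in> verts G" and dist_c: "\<And>v. v \<in> verts G - {c} \<Longrightarrow> graph_dist G c v = 1"
    by blast
  have adj_c: "c \<rightarrow>\<^bsub>G\<^esub> v" if "v \<in> verts G - {c}" for v
    using that c dist_c by (intro G.graph_dist_eq_1D reach) auto
  have trans_c: "?F c c = int n"
    using c assms(3) dist_c by (simp add: distance_laplacian_entry_def transmission_def)
  have no_leaf_edge: False if xy: "x \<rightarrow>\<^bsub>G\<^esub> y" "x \<noteq> c" "y \<noteq> c" for x y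
  proof -
    have "x \<in> verts G" "y \<in> verts G"
      using G.adj_in_verts[OF xy(1)] .
    \<comment> \<open>Rows \<open>c\<close>, \<open>x\<close> and columns \<open>c\<close>, \<open>y\<close>: only the diagonal entry at \<open>c\<close> differs from \<open>- 1\<close>.\<close>
    then have "[1 = - int n] (mod ?q)"
      using minor[of c x c y] xy c trans_c F_adj[OF xy(1)] F_adj[OF adj_c]
      by (simp add: cong_sym_eq)
    then have "?q dvd int n + 1"
      by (simp add: cong_iff_dvd_diff add.commute)
    then have "?q \<le> int n + 1"
      by (rule zdvd_imp_le) simp
    then show False
      using \<open>n \<ge> 1\<close> by simp
  qed
  have "x \<rightarrow>\<^bsub>G\<^esub> y \<longleftrightarrow> x \<in> verts G - {c} \<and> y = c \<or> x = c \<and> y \<in> verts G - {c}" for x y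
    using no_leaf_edge[of x y] adj_c[of x] adj_c[of y] G.graph_symmetric[of c x]
      G.adj_in_verts[of x y] G.adj_not_same[of c]
    by blast
  then have "arcs_ends G = (verts G - {c}) \<times> {c} \<union> {c} \<times> (verts G - {c})"
    by auto
  with c show ?thesis
    unfolding star_with_centre_def by blast
qed

theorem theorem39:
  fixes G :: "('a, 'b) pre_digraph" and K :: "('c, 'd) pre_digraph" and n :: nat
    and vs :: "'a list" and ws :: "'c list"
  assumes "graph G" and "Digraph_Component.connected G"
    and "n \<ge> 1" and "complete_bipartite_digraph n 1 K"
    and "is_vertex_listing G vs" and "is_vertex_listing K ws"
    and "same_smith_normal_form (distance_laplacian_mat G vs) (distance_laplacian_mat K ws)"
  shows "digraph_iso G K"
proof -
  interpret G: graph G by fact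
  let ?F = "distance_laplacian_mat G vs" and ?q = "2 * int n + 1"
  obtain d where K: "graph K" "star_with_centre K d" "card (verts K) = Suc n"
    using assms(4) by (rule complete_bipartite_digraph_1E)
  have len: "length vs = length ws"
    using same_smith_normal_form_dim_row[OF assms(7)] by simp
  then have card_G: "card (verts G) = Suc n"
    using K(3) assms(5,6) by (simp add: length_vertex_listing)
  have "rank_le_one_mod ?q (distance_laplacian_mat K ws)"
    using K assms(6) by (rule star_distance_laplacian_rank_le_one)
  with assms(7) have rank: "rank_le_one_mod ?q ?F"
    by (rule rank_le_one_mod_same_smith_normal_form)
  have index: "\<exists>i < length vs. vs ! i = u" if "u \<in> verts G" for u
    using that assms(5) by (simp add: is_vertex_listing_def in_set_conv_nth[symmetric])
  have "\<exists>c. star_with_centre G c"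
  proof (rule star_if_distance_laplacian_minors_vanish[OF assms(1,2) card_G assms(3)])
    fix u v x y
    assume "u \<in> verts G" "v \<in> verts G" "x \<in> verts G" "y \<in> verts G"
    then obtain i k j l where "i < length vs" "vs ! i = u" "k < length vs" "vs ! k = v"
      "j < length vs" "vs ! j = x" "l < length vs" "vs ! l = y"
      using index by meson
    then show "[distance_laplacian_entry G u x * distance_laplacian_entry G v y =
        distance_laplacian_entry G u y * distance_laplacian_entry G v x] (mod ?q)"
      using rank_le_one_mod_minor[OF rank, of i k j l] G.distance_laplacian_mat_entry[OF assms(5)]
      by simp
  qed
  then obtain c where "star_with_centre G c" ..
  then show ?thesis
    using assms(1) K card_G by (intro stars_of_equal_size_isomorphic) simp_all
qed

end
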